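(* Let $I$ be a finite set, and for $\alpha\in I$, let $C_\alpha$ and $Z_\alpha$ be $\mathbb{Z}_+$-valued random variables, such that the $Z_\alpha$ are mutually independent. Let $\mathbf{w}=(w(\alpha))_{\alpha\in I}$ be a deterministic weight function on $I$ with values in some linear space, let $T=\sum_{\alpha\in I}w(\alpha)Z_\alpha$, and let $t$ be such that $\mathbb{P}(T=t)>0$. For $B\subset I$ write $\mathbf{C}_B=(C_\alpha)_{\alpha\in B}$, $\mathbf{Z}_B=(Z_\alpha)_{\alpha\in B}$, and $$R_B=\sum_{\alpha\in B}w(\alpha)Z_\alpha .$$ If $\mathbf{C}_I\stackrel{d}{=}(\mathbf{Z}_I\mid T=t)$, then for every $B\subset I$ $$d_{TV}(\mathbf{C}_B,\mathbf{Z}_B)=d_{TV}\bigl((R_B\mid T=t),R_B\bigr).$$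
   Context: $\mathbb{Z}_+=\{0,1,2,\ldots\}$. $\stackrel{d}{=}$ denotes equality in distribution and $(X\mid T=t)$ denotes (a random element with) the conditional distribution of $X$ given $\{T=t\}$. For random elements $X,Y$ of a countable set $S$, $d_{TV}(X,Y)=\frac12\sum_{s\in S}|\mathbb{P}(X=s)-\mathbb{P}(Y=s)|$ is the total variation distance between their distributions. *)

theory Defs
  imports "HOL-Probability.Probability"
begin

(* The random vector X_B. Its values are extensional functions, so the countable set of
   its possible values is "B \<rightarrow>\<^sub>E UNIV". *)
definition rvec :: "('i \<Rightarrow> 'a \<Rightarrow> nat) \<Rightarrow> 'i set \<Rightarrow> 'a \<Rightarrow> 'i \<Rightarrow> nat" where
  "rvec X B \<omega> = (\<lambda>\<alpha>\<in>B. X \<alpha> \<omega>)"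

definition weighted_sum ::
  "('k::field \<Rightarrow> 'v::ab_group_add \<Rightarrow> 'v) \<Rightarrow> ('i \<Rightarrow> 'v) \<Rightarrow> 'i set \<Rightarrow> ('i \<Rightarrow> nat) \<Rightarrow> 'v" where
  "weighted_sum smul w B z = (\<Sum>\<alpha>\<in>B. smul (of_nat (z \<alpha>)) (w \<alpha>))"

(* A countable set containing all values of R_B; the linear space itself need not be countable. *)
definition weighted_sums ::
  "('k::field \<Rightarrow> 'v::ab_group_add \<Rightarrow> 'v) \<Rightarrow> ('i \<Rightarrow> 'v) \<Rightarrow> 'i set \<Rightarrow> 'v set" where
  "weighted_sums smul w B = weighted_sum smul w B ` (B \<rightarrow>\<^sub>E UNIV)"

(* For P(E) > 0: the probability space on which a random variable X has the law (X | E). *)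
definition given :: "'a measure \<Rightarrow> ('a \<Rightarrow> bool) \<Rightarrow> 'a measure" where
  "given M E = uniform_measure M {\<omega> \<in> space M. E \<omega>}"

(* S is the countable set in which the random elements X (on M) and Y (on N) take their values. *)
definition eq_distr ::
  "'s set \<Rightarrow> 'a measure \<Rightarrow> ('a \<Rightarrow> 's) \<Rightarrow> 'b measure \<Rightarrow> ('b \<Rightarrow> 's) \<Rightarrow> bool" where
  "eq_distr S M X N Y \<longleftrightarrow> distr M (count_space S) X = distr N (count_space S) Y"

definition d_TV ::
  "'s set \<Rightarrow> 'a measure \<Rightarrow> ('a \<Rightarrow> 's) \<Rightarrow> 'b measure \<Rightarrow> ('b \<Rightarrow> 's) \<Rightarrow> real" where
  "d_TV S M X N Y =
     1 / 2 * (\<Sum>\<^sub>\<infinity>s\<in>S. \<bar>\<P>(\<omega> in M. X \<omega> = s) - \<P>(\<omega> in N. Y \<omega> = s)\<bar>)"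

end

theory Submission
  imports Defs
begin

text \<open>Let \<open>R' = T - R\<^sub>B\<close> be the weighted sum over \<open>I - B\<close>, which is independent of \<open>\<^bold>Z\<^sub>B\<close>. On
  \<open>{R\<^sub>B = r}\<close> the event \<open>{T = t}\<close> is \<open>{R' = t - r}\<close>, so conditioning multiplies the probability of
  any event \<open>{\<^bold>Z\<^sub>B \<in> A} \<subseteq> {R\<^sub>B = r}\<close> by the factor \<open>f r = P(R' = t - r) / P(T = t)\<close>, which depends
  on \<open>r\<close> only. With \<open>A\<close> a point and with \<open>A\<close> a whole fibre of \<open>R\<^sub>B\<close>, one sees that both total
  variation distances are equal to \<open>E \<bar>f R\<^sub>B - 1\<bar> / 2\<close>.\<close>

text \<open>A finite product of countable discrete spaces is again discrete, so the product
  sigma-algebra on the vectors over \<open>A\<close> contains every set of vectors.\<close>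

lemma rvec_measurable:
  assumes "finite A" "\<And>\<alpha>. \<alpha> \<in> A \<Longrightarrow> X \<alpha> \<in> M \<rightarrow>\<^sub>M count_space UNIV"
  shows "rvec X A \<in> M \<rightarrow>\<^sub>M count_space (A \<rightarrow>\<^sub>E UNIV)"
proof -
  have "(\<lambda>\<omega>. \<lambda>\<alpha>\<in>A. X \<alpha> \<omega>) \<in> M \<rightarrow>\<^sub>M Pi\<^sub>M A (\<lambda>_. count_space (UNIV :: nat set))"
    using assms(2) by (rule measurable_restrict)
  then show ?thesis
    using assms(1) by (simp add: count_space_PiM_finite rvec_def[abs_def])
qed

lemma rvec_in_PiE: "rvec X A \<omega> \<in> A \<rightarrow>\<^sub>E UNIV"
  by (simp add: rvec_def)

lemma restrict_rvec: "B \<subseteq> A \<Longrightarrow> restrict (rvec X A \<omega>) B = rvec X B \<omega>"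
  by (auto simp: rvec_def fun_eq_iff)

lemma weighted_sum_rvec: "weighted_sum smul w A (rvec X A \<omega>) = weighted_sum smul w A (\<lambda>\<alpha>. X \<alpha> \<omega>)"
  by (simp add: weighted_sum_def rvec_def)

lemma weighted_sum_Diff:
  assumes "finite I" "B \<subseteq> I"
  shows "weighted_sum smul w I z = weighted_sum smul w B z + weighted_sum smul w (I - B) z"
  unfolding weighted_sum_def using sum.subset_diff[OF assms(2,1)] by (simp add: add.commute)

lemma countable_PiE_nat: "finite A \<Longrightarrow> countable (A \<rightarrow>\<^sub>E (UNIV :: nat set))"
  by (rule countable_PiE) auto

text \<open>On the countable set \<open>S\<close> the law of \<open>Y\<close> has its point masses
  as density with respect to counting measure. The lemma turns sums over different value sets into
  integrals over one common space.\<close>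

lemma (in finite_measure) infsum_measure_eq_integral:
  fixes h :: "'s \<Rightarrow> real"
  assumes Y: "Y \<in> M \<rightarrow>\<^sub>M count_space S" and S: "countable S"
  shows "(\<Sum>\<^sub>\<infinity>s\<in>S. measure M {\<omega> \<in> space M. Y \<omega> = s} * h s) = (\<integral>\<omega>. h (Y \<omega>) \<partial>M)"
proof -
  define p where "p = (\<lambda>s. measure M {\<omega> \<in> space M. Y \<omega> = s})"
  have d: "distr M (count_space S) Y = density (count_space S) (\<lambda>s. ennreal (p s))"
  proof (rule measure_eqI_countable[where A=S])
    fix s assume s: "s \<in> S"
    have "Y -` {s} \<inter> space M = {\<omega> \<in> space M. Y \<omega> = s}" by auto
    then show "emeasure (distr M (count_space S) Y) {s}
        = emeasure (density (count_space S) (\<lambda>s. ennreal (p s))) {s}"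
      using s Y by (simp add: emeasure_distr emeasure_density p_def emeasure_eq_measure)
  qed (use S in auto)
  have "(\<integral>\<omega>. h (Y \<omega>) \<partial>M) = (\<integral>s. h s \<partial>distr M (count_space S) Y)"
    using Y by (subst integral_distr) auto
  also have "\<dots> = (\<integral>s. p s * h s \<partial>count_space S)"
    unfolding d by (subst integral_density) (auto simp: p_def)
  also have "\<dots> = (\<Sum>\<^sub>\<infinity>s\<in>S. p s * h s)"
  proof -
    \<comment> \<open>For real terms, unconditional summability is absolute summability, that is,
      integrability for counting measure.\<close>
    have iff: "integrable (count_space S) (\<lambda>s. p s * h s) \<longleftrightarrow> (\<lambda>s. p s * h s) summable_on S"
      unfolding Infinite_Set_Sum.abs_summable_on_def[symmetric] abs_summable_equivalent[symmetric]
      by (rule summable_on_iff_abs_summable_on_real[symmetric])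
    show ?thesis
    proof (cases "(\<lambda>s. p s * h s) summable_on S")
      case True
      with iff have "Infinite_Set_Sum.abs_summable_on (\<lambda>s. p s * h s) S"
        by (simp add: Infinite_Set_Sum.abs_summable_on_def)
      then show ?thesis
        by (simp add: infsetsum_infsum[symmetric] infsetsum_def abs_summable_equivalent)
    next
      \<comment> \<open>Sum and integral both take their default value 0, so no hypothesis on
        \<open>h\<close> is needed.\<close>
      case False
      with iff show ?thesis by (simp add: not_integrable_integral_eq infsum_not_exists)
    qed
  qed
  finally show ?thesis by (simp add: p_def)
qed

lemma prob_given:
  assumes "{\<omega> \<in> space N. E \<omega>} \<in> sets N" "{\<omega> \<in> space N. P \<omega>} \<in> sets N"
    and "measure N {\<omega> \<in> space N. E \<omega>} > 0" "finite_measure N"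
  shows "\<P>(\<omega> in given N E. P \<omega>) = \<P>(\<omega> in N. P \<omega> \<and> E \<omega>) / \<P>(\<omega> in N. E \<omega>)"
proof -
  have e: "emeasure N {\<omega> \<in> space N. E \<omega>} = ennreal (measure N {\<omega> \<in> space N. E \<omega>})"
    by (rule finite_measure.emeasure_eq_measure[OF assms(4)])
  have i: "{\<omega> \<in> space N. E \<omega>} \<inter> {\<omega> \<in> space N. P \<omega>} = {\<omega> \<in> space N. P \<omega> \<and> E \<omega>}" by auto
  show ?thesis
    unfolding given_def using assms(1-3) e
    by (simp add: measure_uniform_measure i)
qed

text \<open>All subsets of \<open>S\<close> are measurable, so \<open>P\<close> may be arbitrary; a
  predicate on a restriction of the vector gives marginal laws.\<close>

lemma eq_distr_prob_eq:
  assumes "eq_distr S M X N Y" "X \<in> M \<rightarrow>\<^sub>M count_space S" "Y \<in> N \<rightarrow>\<^sub>M count_space S"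
  shows "\<P>(\<omega> in M. P (X \<omega>)) = \<P>(\<omega> in N. P (Y \<omega>))"
proof -
  have "\<P>(\<omega> in M. P (X \<omega>)) = measure (distr M (count_space S) X) {s \<in> S. P s}"
    using assms(2) measurable_space[OF assms(2)]
    by (subst measure_distr) (auto intro!: arg_cong[where f="measure M"])
  also have "\<dots> = measure (distr N (count_space S) Y) {s \<in> S. P s}"
    using assms(1) by (simp add: eq_distr_def)
  also have "\<dots> = \<P>(\<omega> in N. P (Y \<omega>))"
    using assms(3) measurable_space[OF assms(3)]
    by (subst measure_distr) (auto intro!: arg_cong[where f="measure N"])
  finally show ?thesis .
qed

text \<open>Disjoint blocks of an independent family are independent, and discreteness of the two
  product spaces admits arbitrary predicates \<open>P\<close> and \<open>Q\<close>.\<close>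

lemma (in prob_space) indep_vars_prob_rvec:
  assumes "indep_vars (\<lambda>_. count_space UNIV) Z I" "finite I" "A \<subseteq> I" "B \<subseteq> I" "A \<inter> B = {}"
  shows "\<P>(\<omega> in M. P (rvec Z A \<omega>) \<and> Q (rvec Z B \<omega>))
    = \<P>(\<omega> in M. P (rvec Z A \<omega>)) * \<P>(\<omega> in M. Q (rvec Z B \<omega>))"
proof -
  have fin: "finite A" "finite B" using assms finite_subset by blast+
  have "indep_var (Pi\<^sub>M A (\<lambda>_. count_space UNIV)) (\<lambda>\<omega>. \<lambda>\<alpha>\<in>A. Z \<alpha> \<omega>)
      (Pi\<^sub>M B (\<lambda>_. count_space UNIV)) (\<lambda>\<omega>. \<lambda>\<alpha>\<in>B. Z \<alpha> \<omega>)"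
    using indep_var_restrict[OF assms(1,5,3,4)] .
  then have "indep_var (count_space (A \<rightarrow>\<^sub>E UNIV)) (rvec Z A) (count_space (B \<rightarrow>\<^sub>E UNIV)) (rvec Z B)"
    by (simp add: count_space_PiM_finite fin rvec_def[abs_def])
  then have "prob ((\<lambda>\<omega>. (rvec Z A \<omega>, rvec Z B \<omega>)) -`
        ({s \<in> A \<rightarrow>\<^sub>E UNIV. P s} \<times> {s \<in> B \<rightarrow>\<^sub>E UNIV. Q s}) \<inter> space M)
      = prob (rvec Z A -` {s \<in> A \<rightarrow>\<^sub>E UNIV. P s} \<inter> space M)
        * prob (rvec Z B -` {s \<in> B \<rightarrow>\<^sub>E UNIV. Q s} \<inter> space M)"
    by (rule indep_varD) auto
  then show ?thesis
    by (simp add: vimage_def rvec_in_PiE Int_def conj_commute)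
qed

theorem theorem3:
  fixes M :: "'a measure" and N :: "'b measure"
    and I B :: "'i set"
    and C :: "'i \<Rightarrow> 'a \<Rightarrow> nat" and Z :: "'i \<Rightarrow> 'b \<Rightarrow> nat"
    and smul :: "'k::field \<Rightarrow> 'v::ab_group_add \<Rightarrow> 'v"
    and w :: "'i \<Rightarrow> 'v" and t :: 'v
    and R :: "'i set \<Rightarrow> 'b \<Rightarrow> 'v" and T :: "'b \<Rightarrow> 'v"
  assumes "prob_space M" and "prob_space N"
    and "finite I"
    and "\<And>\<alpha>. \<alpha> \<in> I \<Longrightarrow> C \<alpha> \<in> M \<rightarrow>\<^sub>M count_space UNIV"
    and "\<And>\<alpha>. \<alpha> \<in> I \<Longrightarrow> Z \<alpha> \<in> N \<rightarrow>\<^sub>M count_space UNIV"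
    and "prob_space.indep_vars N (\<lambda>_. count_space UNIV) Z I"
    and "vector_space smul"
    and R_def: "\<And>A \<omega>. R A \<omega> = weighted_sum smul w A (\<lambda>\<alpha>. Z \<alpha> \<omega>)"
    and T_def: "\<And>\<omega>. T \<omega> = weighted_sum smul w I (\<lambda>\<alpha>. Z \<alpha> \<omega>)"
    and "\<P>(\<omega> in N. T \<omega> = t) > 0"
    and "eq_distr (I \<rightarrow>\<^sub>E UNIV) M (rvec C I) (given N (\<lambda>\<omega>. T \<omega> = t)) (rvec Z I)"
    and "B \<subseteq> I"
  shows "d_TV (B \<rightarrow>\<^sub>E UNIV) M (rvec C B) N (rvec Z B) =
         d_TV (weighted_sums smul w B) (given N (\<lambda>\<omega>. T \<omega> = t)) (R B) N (R B)"
proof -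
  interpret M: prob_space M by fact
  interpret N: prob_space N by fact
  note finI = assms(3) and mC = assms(4) and mZ = assms(5) and indep = assms(6)
    and pos = assms(10) and eqd = assms(11) and BI = assms(12)
  have finB: "finite B" using finI BI by (rule finite_subset[rotated])
  define G where "G = given N (\<lambda>\<omega>. T \<omega> = t)"
  define W where "W A = weighted_sum smul w A" for A
  \<comment> \<open>There is no division by the probability of \<open>R B \<omega> = r\<close>, so
    values of probability 0 need no separate treatment.\<close>
  define f where "f r = \<P>(\<omega> in N. W (I - B) (rvec Z (I - B) \<omega>) = t - r) / \<P>(\<omega> in N. T \<omega> = t)" for r
  have R_eq: "R A \<omega> = W A (rvec Z A \<omega>)" for A \<omega>
    by (simp add: R_def W_def weighted_sum_rvec)
  have T_eq: "T \<omega> = W B (rvec Z B \<omega>) + W (I - B) (rvec Z (I - B) \<omega>)" for \<omega>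
    unfolding W_def weighted_sum_rvec T_def by (rule weighted_sum_Diff[OF finI BI])
  have mrI: "rvec Z I \<in> N \<rightarrow>\<^sub>M count_space (I \<rightarrow>\<^sub>E UNIV)"
    using finI mZ by (rule rvec_measurable)
  have mrB: "rvec Z B \<in> N \<rightarrow>\<^sub>M count_space (B \<rightarrow>\<^sub>E UNIV)"
    using finB mZ BI by (intro rvec_measurable) auto
  \<comment> \<open>The linear space carries no sigma-algebra; measurability comes from factoring
    \<open>R B\<close> through the discrete space of vectors.\<close>
  have mR: "R B \<in> N \<rightarrow>\<^sub>M count_space (weighted_sums smul w B)"
  proof -
    have "W B \<in> count_space (B \<rightarrow>\<^sub>E UNIV) \<rightarrow>\<^sub>M count_space (weighted_sums smul w B)"
      by (auto simp: W_def weighted_sums_def)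
    from measurable_comp[OF mrB this] show ?thesis
      by (simp add: R_eq[abs_def] comp_def)
  qed
  have sets_I: "{\<omega> \<in> space N. P (rvec Z I \<omega>)} \<in> sets N" for P
  proof -
    have "rvec Z I -` {s \<in> I \<rightarrow>\<^sub>E UNIV. P s} \<inter> space N \<in> sets N"
      by (rule measurable_sets[OF mrI]) auto
    then show ?thesis by (simp add: vimage_def rvec_in_PiE Int_def conj_commute)
  qed
  have sets_B: "{\<omega> \<in> space N. P (rvec Z B \<omega>)} \<in> sets N" for P
    using sets_I[of "\<lambda>z. P (restrict z B)"] by (simp add: restrict_rvec BI)
  have sets_T: "{\<omega> \<in> space N. T \<omega> = t} \<in> sets N"
    using sets_I[of "\<lambda>z. W I z = t"] by (simp add: T_def W_def weighted_sum_rvec)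
  have G_prob: "\<P>(\<omega> in G. P (rvec Z B \<omega>)) = \<P>(\<omega> in N. P (rvec Z B \<omega>)) * f r"
    if P: "\<And>z. P z \<Longrightarrow> W B z = r" for P r
  proof -
    have T_iff: "(P (rvec Z B \<omega>) \<and> T \<omega> = t)
        = (P (rvec Z B \<omega>) \<and> W (I - B) (rvec Z (I - B) \<omega>) = t - r)" for \<omega>
      using P by (auto simp: T_eq algebra_simps)
    have "\<P>(\<omega> in G. P (rvec Z B \<omega>)) = \<P>(\<omega> in N. P (rvec Z B \<omega>) \<and> T \<omega> = t) / \<P>(\<omega> in N. T \<omega> = t)"
      unfolding G_def using sets_T sets_B pos N.finite_measure_axioms by (rule prob_given)
    also have "\<P>(\<omega> in N. P (rvec Z B \<omega>) \<and> T \<omega> = t)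
        = \<P>(\<omega> in N. P (rvec Z B \<omega>) \<and> W (I - B) (rvec Z (I - B) \<omega>) = t - r)"
      by (simp only: T_iff)
    also have "\<P>(\<omega> in N. P (rvec Z B \<omega>) \<and> W (I - B) (rvec Z (I - B) \<omega>) = t - r)
        = \<P>(\<omega> in N. P (rvec Z B \<omega>)) * \<P>(\<omega> in N. W (I - B) (rvec Z (I - B) \<omega>) = t - r)"
      using BI by (intro N.indep_vars_prob_rvec[OF indep finI]) auto
    finally show ?thesis by (simp add: f_def)
  qed
  have C_prob: "\<P>(\<omega> in M. rvec C B \<omega> = b) = \<P>(\<omega> in N. rvec Z B \<omega> = b) * f (W B b)" for b
  proof -
    \<comment> \<open>Conditioning changes neither the space nor the measurable sets. The equality
      of laws is known on \<open>I\<close> only; testing it on \<open>restrict z B = b\<close>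
      passes to the marginal on \<open>B\<close>.\<close>
    have "rvec Z I \<in> G \<rightarrow>\<^sub>M count_space (I \<rightarrow>\<^sub>E UNIV)"
      using mrI by (simp add: G_def given_def measurable_def)
    from eq_distr_prob_eq[OF eqd[folded G_def] rvec_measurable[OF finI mC] this,
        of "\<lambda>z. restrict z B = b"]
    have "\<P>(\<omega> in M. rvec C B \<omega> = b) = \<P>(\<omega> in G. rvec Z B \<omega> = b)"
      by (simp add: restrict_rvec BI)
    also have "\<dots> = \<P>(\<omega> in N. rvec Z B \<omega> = b) * f (W B b)"
      by (rule G_prob) simp
    finally show ?thesis .
  qed
  \<comment> \<open>Here the predicate is the whole fibre \<open>W B z = r\<close>, which makes the
    premise of \<open>G_prob\<close> trivial.\<close>
  have R_prob: "\<P>(\<omega> in G. R B \<omega> = r) = \<P>(\<omega> in N. R B \<omega> = r) * f r" for r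
    unfolding R_eq by (rule G_prob)
  have abs_eq: "\<bar>p * c - p\<bar> = p * \<bar>c - 1\<bar>" if "p \<ge> 0" for p c :: real
    using that abs_mult[of p "c - 1"] by (simp add: right_diff_distrib)
  \<comment> \<open>By \<open>abs_eq\<close> each term is a point mass times a function of the
    point. Passing through the integral over \<open>N\<close> replaces a regrouping of this sum
    along the fibres of \<open>W B\<close>.\<close>
  have "(\<Sum>\<^sub>\<infinity>b\<in>B \<rightarrow>\<^sub>E UNIV. \<bar>\<P>(\<omega> in M. rvec C B \<omega> = b) - \<P>(\<omega> in N. rvec Z B \<omega> = b)\<bar>)
      = (\<integral>\<omega>. \<bar>f (W B (rvec Z B \<omega>)) - 1\<bar> \<partial>N)"
    using N.infsum_measure_eq_integral[OF mrB countable_PiE_nat[OF finB],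
        of "\<lambda>b. \<bar>f (W B b) - 1\<bar>"]
    by (simp add: C_prob abs_eq)
  also have "\<dots> = (\<integral>\<omega>. \<bar>f (R B \<omega>) - 1\<bar> \<partial>N)"
    by (simp add: R_eq)
  also have "\<dots> = (\<Sum>\<^sub>\<infinity>r\<in>weighted_sums smul w B. \<bar>\<P>(\<omega> in G. R B \<omega> = r) - \<P>(\<omega> in N. R B \<omega> = r)\<bar>)"
    using N.infsum_measure_eq_integral[OF mR, of "\<lambda>r. \<bar>f r - 1\<bar>"]
    by (simp add: R_prob abs_eq weighted_sums_def countable_PiE_nat finB)
  finally show ?thesis by (simp add: d_TV_def G_def)
qed

end
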